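(* Let $d\in\mathbb{N}$, and let $(Z_j)_{j\in\mathbb{Z}_+}$ be an independent and identically distributed sequence of $\mathbb{R}^d$-valued random vectors on a probability space $(\Omega,\mathcal{F},\mathbb{P})$. Let $P\in\mathbb{R}^{d\times d}$ be an invertible matrix with spectral radius $\varrho(P)<1$. Then the following assertions are equivalent: (i) $\mathbb{E}_{\mathbb{P}}(\log^+(\|Z_0\|))<\infty$. (ii) $\sum_{j=0}^\infty \|P^jZ_j\|<\infty$ $\mathbb{P}$-almost surely. (iii) $\sum_{j=0}^\infty P^jZ_j$ converges $\mathbb{P}$-almost surely in $\mathbb{R}^d$. (iv) $P^jZ_j\to 0$ as $j\to\infty$ $\mathbb{P}$-almost surely.
   Context: $\mathbb{Z}_+$ is the set of non-negative integers, $\mathbb{N}$ the set of positive integers. $\|\cdot\|$ is the Euclidean norm on $\mathbb{R}^d$. For $x\ge 0$, $\log^+(x):=\log(x)$ if $x\ge 1$ and $\log^+(x):=0$ if $0\le x<1$. $\varrho(P)$ denotes the spectral radius of $P$ (maximum modulus of its complex eigenvalues). $\mathbb{E}_{\mathbb{P}}$ denotes expectation under $\mathbb{P}$. *)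

theory Defs
  imports "HOL-Probability.Probability"
begin

definition log_plus :: "real \<Rightarrow> real" where
  "log_plus x = (if 1 \<le> x then ln x else 0)"

(* The power operation of the type real ^ 'n ^ 'n is componentwise, so the power with respect
   to the matrix product is defined here. *)
primrec matrix_power :: "'a::semiring_1 ^ 'n ^ 'n \<Rightarrow> nat \<Rightarrow> 'a ^ 'n ^ 'n" where
  "matrix_power A 0 = mat 1"
| "matrix_power A (Suc j) = A ** matrix_power A j"

definition complex_eigenvalues :: "real ^ 'n ^ 'n \<Rightarrow> complex set" where
  "complex_eigenvalues A =
     {c. \<exists>v :: complex ^ 'n. v \<noteq> 0 \<and> map_matrix complex_of_real A *v v = c *s v}"

(* The maximum is well defined: the index type is finite and nonempty, so a matrix has at least
   one and only finitely many complex eigenvalues. *)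
definition matrix_spectral_radius :: "real ^ 'n ^ 'n \<Rightarrow> real" where
  "matrix_spectral_radius A = Max (cmod ` complex_eigenvalues A)"

definition (in prob_space) iid_sequence :: "(nat \<Rightarrow> 'a \<Rightarrow> 'b::topological_space) \<Rightarrow> bool" where
  "iid_sequence Z \<longleftrightarrow>
     indep_vars (\<lambda>_. borel) Z UNIV \<and> (\<forall>j. distr M borel (Z j) = distr M borel (Z 0))"

end

theory Submission
  imports Defs "HOL-Computational_Algebra.Fundamental_Theorem_Algebra"
begin

text \<open>
  The powers of \<open>P\<close> satisfy \<open>c ^ j * norm v \<le> norm (P\<^sup>j v) \<le> C * r ^ j * norm v\<close> with
  \<open>0 < c < 1\<close> (invertibility) and \<open>r < 1\<close> (spectral radius). Hence all four
  assertions amount to \<open>norm (Z j)\<close> eventually staying below \<open>exp (e * j)\<close> almost surely, for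
  one or equivalently every \<open>e > 0\<close>, which by the two
  Borel--Cantelli lemmas means that the tail probabilities of \<open>log_plus (norm (Z 0))\<close> along the
  multiples of \<open>e\<close> are summable, that is, that this variable is integrable.

  For the upper bound, the complexified matrix is annihilated by a nonzero polynomial, which
  splits into linear factors. A factor whose root is not an eigenvalue acts injectively and can be
  cancelled; a factor with root \<open>x\<close>, \<open>cmod x < r\<close>, gives the scalar recursion
  \<open>b (Suc j) \<le> cmod x * b j + C * r ^ j\<close>, which preserves the rate \<open>r\<close>.
\<close>

section \<open>Powers of a matrix\<close>

text \<open>Horner's scheme for \<open>p(A) v\<close>. Working on vectors avoids forming the matrix
  \<open>p(A)\<close>.\<close>

definition poly_act :: "'a::comm_semiring_1 ^ 'n ^ 'n \<Rightarrow> 'a poly \<Rightarrow> 'a ^ 'n \<Rightarrow> 'a ^ 'n" where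
  "poly_act A p v = fold_coeffs (\<lambda>a w. a *s v + A *v w) p 0"

lemma poly_act_0 [simp]: "poly_act A 0 v = 0"
  by (simp add: poly_act_def)

lemma poly_act_pCons [simp]: "poly_act A (pCons a p) v = a *s v + A *v poly_act A p v"
  by (cases "p = 0"; cases "a = 0") (simp_all add: poly_act_def)

lemma matrix_vector_mult_smult:
  "A *v (c *s v) = c *s (A *v (v :: 'a::comm_semiring_1 ^ 'n))"
  by (simp add: matrix_vector_mult_def vec_eq_iff sum_distrib_left mult.left_commute)

lemma poly_act_add: "poly_act A (p + q) v = poly_act A p v + poly_act A q v"
  by (induction p q rule: poly_induct2)
     (simp_all add: matrix_vector_right_distrib add_ac)

lemma poly_act_smult: "poly_act A (smult c p) v = c *s poly_act A p v"
  by (induction p)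
     (simp_all add: matrix_vector_mult_smult)

lemma poly_act_mult: "poly_act A (p * q) v = poly_act A p (poly_act A q v)"
  by (induction p) (simp_all add: poly_act_add poly_act_smult)

lemma poly_act_sum: "poly_act A (\<Sum>i\<in>I. f i) v = (\<Sum>i\<in>I. poly_act A (f i) v)"
  by (induction I rule: infinite_finite_induct) (simp_all add: poly_act_add)

lemma matrix_power_Suc_mult_vec: "matrix_power A (Suc j) *v v = A *v (matrix_power A j *v v)"
  by (simp add: matrix_vector_mul_assoc)

lemma matrix_power_mult_vec_comm:
  "matrix_power A j *v (A *v v) = A *v (matrix_power A j *v v)"
  by (induction j) (simp_all add: matrix_vector_mul_assoc [symmetric])

lemma poly_act_monom: "poly_act A (monom c i) v = c *s (matrix_power A i *v v)"
  by (induction i)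
     (simp_all add: monom_0 monom_Suc matrix_vector_mul_assoc [symmetric] matrix_vector_mult_smult)

lemma poly_act_eigenvector:
  assumes "A *v v = c *s v"
  shows "poly_act A p v = poly p c *s v"
  by (induction p)
     (simp_all add: assms matrix_vector_mult_smult mult_ac)

text \<open>One more index than the dimension forces a relation. The family is indexed because its
  entries may coincide: a repetition gives the coefficients 1 and -1, and without repetitions the
  image is too large to be independent.\<close>

lemma sequence_linear_dependence:
  fixes f :: "nat \<Rightarrow> 'a::euclidean_space"
  obtains c where "\<exists>i\<le>DIM('a). c i \<noteq> 0" "(\<Sum>i\<le>DIM('a). c i *\<^sub>R f i) = 0"
proof (cases "inj_on f {..DIM('a)}")
  case True
  have "dependent (f ` {..DIM('a)})"
    by (rule dependent_biggerset) (simp add: card_image True)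
  then obtain u where "\<exists>v\<in>f ` {..DIM('a)}. u v \<noteq> 0"
      "(\<Sum>v\<in>f ` {..DIM('a)}. u v *\<^sub>R v) = 0"
    by (auto simp: dependent_finite)
  then show ?thesis
    by (intro that [of "u \<circ> f"]) (auto simp: sum.reindex True)
next
  case False
  then obtain i j where ij: "i \<le> DIM('a)" "j \<le> DIM('a)" "i \<noteq> j" "f i = f j"
    by (auto simp: inj_on_def)
  let ?c = "\<lambda>k. (if k = i then 1 else 0) - (if k = j then 1 else 0) :: real"
  have "(\<Sum>k\<le>DIM('a). ?c k *\<^sub>R f k) = 0"
    using ij by (simp add: scaleR_diff_left sum_subtractf if_distrib [of "\<lambda>x. x *\<^sub>R _"] cong: if_cong)
  with ij show ?thesis
    by (intro that [of ?c]) auto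
qed

text \<open>A substitute for Cayley-Hamilton: the powers of \<open>A\<close> lie in a real vector
  space of finite dimension, so a nontrivial real relation between finitely many of them supplies
  the coefficients.\<close>

lemma annihilating_poly_exists:
  fixes A :: "complex ^ 'n ^ 'n"
  obtains p where "p \<noteq> 0" "\<And>v. poly_act A p v = 0"
proof -
  let ?N = "DIM(complex ^ 'n ^ 'n)"
  obtain c where c: "\<exists>i\<le>?N. c i \<noteq> 0" "(\<Sum>i\<le>?N. c i *\<^sub>R matrix_power A i) = 0"
    using sequence_linear_dependence [of "matrix_power A"] by blast
  define p where "p = (\<Sum>i\<le>?N. monom (complex_of_real (c i)) i)"
  have "coeff p i = c i" if "i \<le> ?N" for i
    using that by (simp add: p_def coeff_sum)
  with c(1) have "p \<noteq> 0"
    by (metis coeff_0 of_real_eq_0_iff)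
  moreover have "poly_act A p v = 0" for v
  proof -
    have "poly_act A p v = (\<Sum>i\<le>?N. complex_of_real (c i) *s (matrix_power A i *v v))"
      by (simp add: p_def poly_act_sum poly_act_monom)
    also have "\<dots> = (\<Sum>i\<le>?N. c i *\<^sub>R matrix_power A i) *v v"
      unfolding vec_eq_iff matrix_vector_mult_def
      by (simp add: sum_distrib_left sum_distrib_right scaleR_conv_of_real [where 'a = complex] mult.assoc)
         (use sum.swap in fast)
    finally show ?thesis
      using c(2) by simp
  qed
  ultimately show ?thesis
    using that by blast
qed

section \<open>Growth of the orbits of a complex matrix\<close>

lemma norm_smult_vec: "norm (c *s v) = norm c * norm (v :: 'a::real_normed_div_algebra ^ 'n)"
  by (simp add: norm_vec_def norm_mult L2_set_right_distrib)

lemma linear_recursion_geometric_bound: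
  fixes b :: "nat \<Rightarrow> real"
  assumes "0 \<le> a" "a < r" and step: "\<And>j. b (Suc j) \<le> a * b j + C * r ^ j"
  shows "\<exists>K. \<forall>j. b j \<le> K * r ^ j"
proof -
  \<comment> \<open>\<open>b 0\<close> starts the induction; \<open>C / (r - a)\<close> solves
    \<open>a * K + C = K * r\<close>, so any larger \<open>K\<close> lets the induction step
    close.\<close>
  define K where "K = max (b 0) (C / (r - a))"
  have "C \<le> K * (r - a)"
    using assms by (simp add: K_def pos_divide_le_eq [symmetric])
  then have K: "a * K + C \<le> K * r"
    by (simp add: algebra_simps)
  have "b j \<le> K * r ^ j" for j
  proof (induction j)
    case 0
    show ?case by (simp add: K_def)
  next
    case (Suc j)
    have "b (Suc j) \<le> a * (K * r ^ j) + C * r ^ j"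
      using step [of j] mult_left_mono [OF Suc \<open>0 \<le> a\<close>] by linarith
    also have "\<dots> = (a * K + C) * r ^ j"
      by (simp add: algebra_simps)
    also have "\<dots> \<le> (K * r) * r ^ j"
      using K assms by (intro mult_right_mono) auto
    finally show ?case by (simp add: mult_ac)
  qed
  then show ?thesis by blast
qed

lemma matrix_power_orbit_bound:
  fixes A :: "complex ^ 'n ^ 'n"
  assumes r: "0 < r"
    and eig: "\<And>c v. v \<noteq> 0 \<Longrightarrow> A *v v = c *s v \<Longrightarrow> cmod c < r"
  shows "\<exists>C. \<forall>j. norm (matrix_power A j *v v) \<le> C * r ^ j"
proof -
  obtain p where p: "p \<noteq> 0" "\<And>v. poly_act A p v = 0"
    using annihilating_poly_exists by blast
  obtain X where X: "p = smult (lead_coeff p) (\<Prod>x\<in>#X. [:-x, 1:])"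
    using alg_closed_imp_factorization [OF p(1)] by blast
  have "lead_coeff p *s poly_act A (\<Prod>x\<in>#X. [:-x, 1:]) v = 0"
    using p(2) X by (metis poly_act_smult)
  then have "poly_act A (\<Prod>x\<in>#X. [:-x, 1:]) v = 0"
    using p(1) by simp
  then show ?thesis
  \<comment> \<open>Induction on the multiset of roots; \<open>v\<close> is generalised because the
    hypothesis is also applied to \<open>A *v v - x *s v\<close>.\<close>
  proof (induction X arbitrary: v)
    case empty
    then have "v = 0"
      by (simp add: one_pCons)
    then show ?case
      by (auto intro!: exI [of _ 0])
  next
    case (add x X)
    let ?q = "\<Prod>x\<in>#X. [:-x, 1:]"
    have lin: "poly_act A [:-x, 1:] w = A *v w - x *s w" for w
      by (simp add: vec_eq_iff)
    have left: "A *v poly_act A ?q v = x *s poly_act A ?q v"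
      using add.prems by (simp add: poly_act_mult lin del: mult_pCons_left poly_act_pCons)
    \<comment> \<open>The factors commute, so the shorter product annihilates the image of
      \<open>v\<close> under the removed factor.\<close>
    have right: "poly_act A ?q (A *v v - x *s v) = 0"
      using add.prems by (simp only: image_mset_add_mset prod_mset.add_mset
          mult.commute [of "[:-x, 1:]"] poly_act_mult lin)
    show ?case
    proof (cases "poly_act A ?q v = 0")
      case True
      then show ?thesis by (rule add.IH)
    next
      case False
      then have x: "cmod x < r"
        using eig left by blast
      obtain C where C: "\<And>j. norm (matrix_power A j *v (A *v v - x *s v)) \<le> C * r ^ j"
        using add.IH [OF right] by blast
      show ?thesis
      proof (rule linear_recursion_geometric_bound)
        fix j
        have "matrix_power A (Suc j) *v v =
            x *s (matrix_power A j *v v) + matrix_power A j *v (A *v v - x *s v)"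
          by (simp add: matrix_power_Suc_mult_vec matrix_vector_mult_diff_distrib
              matrix_power_mult_vec_comm matrix_vector_mult_smult del: matrix_power.simps)
        then show "norm (matrix_power A (Suc j) *v v) \<le>
            cmod x * norm (matrix_power A j *v v) + C * r ^ j"
          using C [of j] norm_triangle_ineq [of "x *s (matrix_power A j *v v)"]
          by (smt (verit) norm_smult_vec)
      qed (use x in auto)
    qed
  qed
qed

text \<open>Eigenvalues are roots of any annihilating polynomial. Finiteness makes the
  \<open>Max\<close> in the spectral radius a genuine upper bound.\<close>

lemma finite_complex_eigenvalues: "finite (complex_eigenvalues A)"
proof -
  obtain p where p: "p \<noteq> 0" "\<And>v. poly_act (map_matrix complex_of_real A) p v = 0"
    using annihilating_poly_exists by blast
  have "complex_eigenvalues A \<subseteq> {c. poly p c = 0}"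
    using p(2) by (auto simp: complex_eigenvalues_def) (metis poly_act_eigenvector vector_mul_eq_0)
  then show ?thesis
    using poly_roots_finite [OF p(1)] finite_subset by blast
qed

section \<open>Bounds for the powers of a real matrix\<close>

lemma map_matrix_of_real_mult_vec:
  "map_matrix complex_of_real A *v (\<chi> i. complex_of_real (v $ i)) =
    (\<chi> i. complex_of_real ((A *v v) $ i))"
  by (simp add: matrix_vector_mult_def vec_eq_iff)

lemma matrix_power_map_matrix_of_real_mult_vec:
  "matrix_power (map_matrix complex_of_real A) j *v (\<chi> i. complex_of_real (v $ i)) =
    (\<chi> i. complex_of_real ((matrix_power A j *v v) $ i))"
  by (induction j)
     (simp_all add: matrix_vector_mul_assoc [symmetric] map_matrix_of_real_mult_vec)

lemma norm_complexify: "norm (\<chi> i. complex_of_real (v $ i)) = norm v"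
  by (simp add: norm_vec_def)

lemma matrix_power_spectral_bound:
  fixes A :: "real ^ 'n ^ 'n"
  assumes "matrix_spectral_radius A < r" "0 < r"
  obtains C where "\<And>j v. norm (matrix_power A j *v v) \<le> C * r ^ j * norm v"
proof -
  have eig: "cmod c < r" if "v \<noteq> 0" "map_matrix complex_of_real A *v v = c *s v" for c v
  proof -
    have "cmod c \<le> matrix_spectral_radius A"
      unfolding matrix_spectral_radius_def
      using that by (intro Max_ge finite_imageI finite_complex_eigenvalues)
        (auto simp: complex_eigenvalues_def)
    then show ?thesis using assms by simp
  qed
  have "\<exists>C. \<forall>j. norm (matrix_power A j *v v) \<le> C * r ^ j" for v
    using matrix_power_orbit_bound [where A = "map_matrix complex_of_real A"
        and v = "\<chi> i. complex_of_real (v $ i)", OF assms(2) eig]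
    unfolding matrix_power_map_matrix_of_real_mult_vec norm_complexify .
  then have "\<forall>v. \<exists>C. \<forall>j. norm (matrix_power A j *v v) \<le> C * r ^ j" ..
  then obtain C where C: "\<And>v j. norm (matrix_power A j *v v) \<le> C v * r ^ j"
    unfolding choice_iff by blast
  \<comment> \<open>So far the constant depends on the vector. Expanding \<open>v\<close> in the
    standard basis gives a uniform one, the sum of the constants of the basis vectors.\<close>
  have "norm (matrix_power A j *v v) \<le> (\<Sum>i\<in>UNIV. C (axis i 1)) * r ^ j * norm v" for j v
  proof -
    have "norm (matrix_power A j *v v) =
        norm (\<Sum>i\<in>UNIV. v $ i *s (matrix_power A j *v axis i 1))"
      by (subst matrix_mult_sum) (simp only: matrix_vector_mult_basis)
    also have "\<dots> \<le> (\<Sum>i\<in>UNIV. \<bar>v $ i\<bar> * norm (matrix_power A j *v axis i 1))"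
      using norm_sum [of "\<lambda>i. v $ i *s (matrix_power A j *v axis i 1)" UNIV]
      by (simp only: norm_smult_vec real_norm_def)
    also have "\<dots> \<le> (\<Sum>i\<in>UNIV. norm v * (C (axis i 1) * r ^ j))"
      by (intro sum_mono mult_mono C component_le_norm_cart) auto
    finally show ?thesis
      by (simp add: sum_distrib_left sum_distrib_right mult_ac)
  qed
  then show ?thesis by (rule that)
qed

lemma invertible_matrix_power_lower_bound:
  fixes A :: "real ^ 'n ^ 'n"
  assumes "invertible A"
  obtains c where "0 < c" "c < 1" "\<And>j v. c ^ j * norm v \<le> norm (matrix_power A j *v v)"
proof -
  have "inj ((*v) A)"
    using assms by (simp add: inj_matrix_vector_mult)
  then obtain B where B: "0 < B" "\<And>x. B * norm x \<le> norm (A *v x)"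
    using linear_inj_bounded_below_pos [of "(*v) A"] by auto
  \<comment> \<open>The cap at 1/2 ensures \<open>c < 1\<close>, so that \<open>- ln c\<close> is a
    positive rate in the main proof.\<close>
  define c where "c = min B (1/2)"
  have c: "0 < c" "c < 1" "c \<le> B"
    using B by (auto simp: c_def)
  have "c ^ j * norm v \<le> norm (matrix_power A j *v v)" for j v
  proof (induction j)
    case (Suc j)
    have "c * (c ^ j * norm v) \<le> B * norm (matrix_power A j *v v)"
      using Suc c by (intro mult_mono) auto
    also have "\<dots> \<le> norm (matrix_power A (Suc j) *v v)"
      unfolding matrix_power_Suc_mult_vec by (rule B)
    finally show ?case by (simp add: mult_ac)
  qed simp
  with c that show ?thesis by blast
qed

section \<open>Tail sums and Borel--Cantelli\<close>

text \<open>Rounding \<open>X / e\<close> up to a natural number \<open>N\<close> changes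
  \<open>X\<close> by at most \<open>e\<close> after rescaling, which is harmless on a probability
  space. The integral of \<open>N\<close> is the sum of the probabilities of \<open>t < N\<close>,
  that is, of \<open>e * t < X\<close>.\<close>

lemma (in prob_space) nn_integral_finite_iff_summable_tail:
  fixes X :: "'a \<Rightarrow> real"
  assumes X [measurable]: "random_variable borel X"
    and nonneg: "\<And>x. 0 \<le> X x" and e: "0 < e"
  shows "(\<integral>\<^sup>+ x. ennreal (X x) \<partial>M) < \<infinity> \<longleftrightarrow>
    summable (\<lambda>j. prob {x \<in> space M. e * real j < X x})"
proof -
  define N where "N x = nat \<lceil>X x / e\<rceil>" for x
  have N_meas [measurable]: "N \<in> measurable M (count_space UNIV)"
    unfolding N_def by measurable
  have N_iff: "t < N x \<longleftrightarrow> e * real t < X x" for t x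
    using e by (simp add: N_def zless_nat_eq_int_zless less_ceiling_iff pos_less_divide_eq mult.commute)
  have N_ge: "X x \<le> e * real (N x)" for x
    using N_iff [of "N x" x] by simp
  have N_le: "e * real (N x) \<le> X x + e" for x
  proof (cases "N x")
    case 0
    then show ?thesis using nonneg [of x] e by simp
  next
    case (Suc k)
    then have "e * real k < X x"
      using N_iff [of k x] by simp
    then show ?thesis by (simp add: Suc algebra_simps)
  qed
  have "(\<integral>\<^sup>+ x. ennreal (X x) \<partial>M) < \<infinity> \<longleftrightarrow> (\<integral>\<^sup>+ x. of_nat (N x) \<partial>M) < (\<infinity> :: ennreal)"
  proof
    assume fin: "(\<integral>\<^sup>+ x. ennreal (X x) \<partial>M) < \<infinity>"
    have "ennreal e * (\<integral>\<^sup>+ x. of_nat (N x) \<partial>M) = (\<integral>\<^sup>+ x. ennreal (e * real (N x)) \<partial>M)"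
      using e by (simp add: nn_integral_cmult [symmetric] ennreal_mult ennreal_of_nat_eq_real_of_nat)
    also have "\<dots> \<le> (\<integral>\<^sup>+ x. ennreal (X x) + ennreal e \<partial>M)"
      using N_le nonneg e by (intro nn_integral_mono) (simp add: ennreal_plus [symmetric] del: ennreal_plus)
    also have "\<dots> = (\<integral>\<^sup>+ x. ennreal (X x) \<partial>M) + ennreal e"
      by (subst nn_integral_add) (auto simp: emeasure_space_1)
    also have "\<dots> < \<infinity>"
      using fin by simp
    finally show "(\<integral>\<^sup>+ x. of_nat (N x) \<partial>M) < (\<infinity> :: ennreal)"
      using e by (auto simp: ennreal_mult_less_top)
  next
    assume fin: "(\<integral>\<^sup>+ x. of_nat (N x) \<partial>M) < (\<infinity> :: ennreal)"
    have "(\<integral>\<^sup>+ x. ennreal (X x) \<partial>M) \<le> (\<integral>\<^sup>+ x. ennreal (e * real (N x)) \<partial>M)"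
      by (intro nn_integral_mono ennreal_leI N_ge)
    also have "\<dots> = ennreal e * (\<integral>\<^sup>+ x. of_nat (N x) \<partial>M)"
      using e by (simp add: nn_integral_cmult [symmetric] ennreal_mult ennreal_of_nat_eq_real_of_nat)
    also have "\<dots> < \<infinity>"
      using fin by (simp add: ennreal_mult_less_top)
    finally show "(\<integral>\<^sup>+ x. ennreal (X x) \<partial>M) < \<infinity>" .
  qed
  also have "(\<integral>\<^sup>+ x. of_nat (N x) \<partial>M) =
      (\<Sum>t. ennreal (prob {x \<in> space M. e * real t < X x}))"
    by (simp add: nn_integral_nat_function N_iff emeasure_eq_measure)
  also have "\<dots> < \<infinity> \<longleftrightarrow> summable (\<lambda>j. prob {x \<in> space M. e * real j < X x})"
  proof
    assume "(\<Sum>t. ennreal (prob {x \<in> space M. e * real t < X x})) < \<infinity>"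
    then show "summable (\<lambda>j. prob {x \<in> space M. e * real j < X x})"
      by (intro summable_suminf_not_top) auto
  next
    assume "summable (\<lambda>j. prob {x \<in> space M. e * real j < X x})"
    then show "(\<Sum>t. ennreal (prob {x \<in> space M. e * real t < X x})) < \<infinity>"
      by (subst suminf_ennreal2) auto
  qed
  finally show ?thesis .
qed

text \<open>The second Borel-Cantelli lemma in contrapositive form. Some tail intersection
  \<open>G m\<close> has positive probability, and independence turns this into a bound on the
  partial sums.\<close>

lemma (in prob_space) indep_events_summable_compl:
  fixes F :: "nat \<Rightarrow> 'a set"
  assumes indep: "indep_events F UNIV"
    and ae: "AE x in M. eventually (\<lambda>j. x \<in> F j) sequentially"
  shows "summable (\<lambda>j. 1 - prob (F j))"
proof -
  have F [measurable]: "F j \<in> events" for j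
    using indep by (auto simp: indep_events_def)
  define G where "G m = (\<Inter>j\<in>{m..}. F j)" for m
  have G [measurable]: "G m \<in> events" for m
    unfolding G_def by measurable
  \<comment> \<open>Otherwise countably many null sets \<open>G m\<close> would cover almost every
    point.\<close>
  obtain m where m: "prob (G m) > 0"
  proof (rule ccontr)
    assume "\<not> thesis"
    then have "prob (G m) = 0" for m
      using that [of m] by (auto simp: zero_less_measure_iff)
    then have "AE x in M. \<forall>m. x \<notin> G m"
      unfolding AE_all_countable by (auto simp: prob_eq_0)
    with ae have "AE x in M. False"
      by eventually_elim (auto simp: G_def eventually_sequentially)
    then show False
      by simp
  qed
  have bound: "(\<Sum>j<n. 1 - prob (F (j + m))) \<le> - ln (prob (G m))" for n
  \<comment> \<open>Independence gives the product formula only for nonempty index sets.\<close>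
  proof (cases "n = 0")
    case True
    then show ?thesis using m by simp
  next
    case False
    have "prob (G m) \<le> prob (\<Inter>j\<in>{m..<n+m}. F j)"
      using False by (intro finite_measure_mono) (auto simp: G_def)
    also have "\<dots> = (\<Prod>j\<in>{m..<n+m}. prob (F j))"
      using indep False by (auto simp: indep_events_def)
    also have "\<dots> = (\<Prod>j<n. prob (F (j + m)))"
      using prod.shift_bounds_nat_ivl [of "\<lambda>j. prob (F j)" 0 m n] by (simp add: atLeast0LessThan)
    \<comment> \<open>Each factor is bounded by \<open>1 + y <= exp y\<close> with
      \<open>y = prob (F (j + m)) - 1\<close>.\<close>
    also have "\<dots> \<le> (\<Prod>j<n. exp (- (1 - prob (F (j + m)))))"
      by (intro prod_mono) (smt (verit) exp_ge_add_one_self measure_nonneg)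
    also have "\<dots> = exp (- (\<Sum>j<n. 1 - prob (F (j + m))))"
      by (simp only: exp_sum [symmetric] sum_negf finite_lessThan)
    finally have "ln (prob (G m)) \<le> - (\<Sum>j<n. 1 - prob (F (j + m)))"
      using m by (metis ln_exp ln_mono)
    then show ?thesis by linarith
  qed
  have "summable (\<lambda>j. 1 - prob (F (j + m)))"
    by (rule bounded_imp_summable [where B = "- ln (prob (G m))"])
       (simp_all only: lessThan_Suc_atMost [symmetric] bound, simp)
  then show ?thesis
    by (subst (asm) summable_iff_shift)
qed

section \<open>Logarithmic moments of an i.i.d. sequence\<close>

lemma less_log_plus_iff:
  assumes "0 \<le> t" "0 \<le> x"
  shows "t < log_plus x \<longleftrightarrow> exp t < x"
proof (cases "1 \<le> x")
  case True
  then have "t < ln x \<longleftrightarrow> exp t < x"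
    by (metis exp_less_cancel_iff exp_ln less_le_trans zero_less_one)
  with True show ?thesis by (simp add: log_plus_def)
next
  case False
  \<comment> \<open>For \<open>x < 1\<close> both sides are false:
    \<open>log_plus x = 0 <= t\<close> and \<open>x < 1 <= exp t\<close>.\<close>
  moreover have "1 \<le> exp t"
    using assms by simp
  ultimately show ?thesis
    using assms by (smt (verit) log_plus_def)
qed

text \<open>The left side does not contain \<open>e\<close>, so the growth conditions for all
  positive rates are equivalent. This lets the two bounds on the matrix powers be used with
  different rates.\<close>

lemma (in prob_space) iid_log_plus_moment_iff:
  fixes Z :: "nat \<Rightarrow> 'a \<Rightarrow> 'b::{real_normed_vector, second_countable_topology}"
  assumes iid: "iid_sequence Z" and e: "0 < e"
  shows "(\<integral>\<^sup>+ x. ennreal (log_plus (norm (Z 0 x))) \<partial>M) < \<infinity> \<longleftrightarrow>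
    (AE x in M. eventually (\<lambda>j. norm (Z j x) \<le> exp (e * real j)) sequentially)"
proof -
  have indep: "indep_vars (\<lambda>_. borel) Z UNIV" and distr: "\<And>j. distr M borel (Z j) = distr M borel (Z 0)"
    using iid by (auto simp: iid_sequence_def)
  have Z [measurable]: "random_variable borel (Z j)" for j
    using indep by (auto simp: indep_vars_def)
  define E where "E j = {x \<in> space M. exp (e * real j) < norm (Z j x)}" for j
  have E [measurable]: "E j \<in> events" for j
    unfolding E_def by measurable
  have prob_E: "prob (E j) = prob {x \<in> space M. e * real j < log_plus (norm (Z 0 x))}" for j
  proof -
    \<comment> \<open>Expressed through the law of \<open>Z i\<close>, the tail probability is the
      same for every \<open>i\<close>.\<close>
    have *: "prob {x \<in> space M. exp (e * real j) < norm (Z i x)} =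
        measure (distr M borel (Z i)) {z. exp (e * real j) < norm z}" for i
      by (subst measure_distr) (auto intro!: arg_cong [where f = prob])
    have "prob (E j) = prob {x \<in> space M. exp (e * real j) < norm (Z 0 x)}"
      unfolding E_def * by (metis distr)
    then show ?thesis
      using e by (simp add: less_log_plus_iff)
  qed
  have lp [measurable]: "log_plus \<in> borel_measurable borel"
    unfolding log_plus_def by measurable
  have "(\<integral>\<^sup>+ x. ennreal (log_plus (norm (Z 0 x))) \<partial>M) < \<infinity> \<longleftrightarrow> summable (\<lambda>j. prob (E j))"
    unfolding prob_E
    by (rule nn_integral_finite_iff_summable_tail) (auto simp: log_plus_def e)
  also have "\<dots> \<longleftrightarrow> (AE x in M. eventually (\<lambda>j. norm (Z j x) \<le> exp (e * real j)) sequentially)"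
  proof
    assume "summable (\<lambda>j. prob (E j))"
    then have "AE x in M. eventually (\<lambda>j. x \<in> space M - E j) sequentially"
      by (intro borel_cantelli_AE1) (auto simp: emeasure_eq_measure)
    then show "AE x in M. eventually (\<lambda>j. norm (Z j x) \<le> exp (e * real j)) sequentially"
      by (rule AE_mp) (auto elim!: eventually_mono simp: E_def)
  next
    assume ae: "AE x in M. eventually (\<lambda>j. norm (Z j x) \<le> exp (e * real j)) sequentially"
    define F where "F j = {x \<in> space M. norm (Z j x) \<le> exp (e * real j)}" for j
    have "summable (\<lambda>j. 1 - prob (F j))"
    proof (rule indep_events_summable_compl)
      show "indep_events F UNIV"
        unfolding F_def by (rule indep_eventsI_indep_vars [OF indep]) simp
      show "AE x in M. eventually (\<lambda>j. x \<in> F j) sequentially"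
        using ae by (rule AE_mp) (auto elim!: eventually_mono simp: F_def)
    qed
    moreover have "1 - prob (F j) = prob (E j)" for j
    proof -
      have "F j = space M - E j"
        by (auto simp: E_def F_def)
      then show ?thesis by (simp add: prob_compl)
    qed
    ultimately show "summable (\<lambda>j. prob (E j))" by simp
  qed
  finally show ?thesis .
qed

section \<open>The four assertions, proved in a cycle\<close>

theorem lemma1p3:
  fixes M :: "'a measure"
    and Z :: "nat \<Rightarrow> 'a \<Rightarrow> real ^ 'd"
    and P :: "real ^ 'd ^ 'd"
  assumes "prob_space M"
    and "prob_space.iid_sequence M Z"
    and "invertible P"
    and "matrix_spectral_radius P < 1"
  shows "((\<integral>\<^sup>+ \<omega>. ennreal (log_plus (norm (Z 0 \<omega>))) \<partial>M) < \<infinity>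
            \<longleftrightarrow> (AE \<omega> in M. summable (\<lambda>j. norm (matrix_power P j *v Z j \<omega>))))
       \<and> ((AE \<omega> in M. summable (\<lambda>j. norm (matrix_power P j *v Z j \<omega>)))
            \<longleftrightarrow> (AE \<omega> in M. summable (\<lambda>j. matrix_power P j *v Z j \<omega>)))
       \<and> ((AE \<omega> in M. summable (\<lambda>j. matrix_power P j *v Z j \<omega>))
            \<longleftrightarrow> (AE \<omega> in M. (\<lambda>j. matrix_power P j *v Z j \<omega>) \<longlonglongrightarrow> 0))"
    (is "(?i \<longleftrightarrow> ?ii) \<and> (_ \<longleftrightarrow> ?iii) \<and> (_ \<longleftrightarrow> ?iv)")
proof -
  interpret prob_space M by fact
  have "?ii" if "?i"
  proof -
    \<comment> \<open>The midpoint between the spectral radius and 1, raised to at least 1/2 so that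
      \<open>r\<close> is positive.\<close>
    define r where "r = max (1/2) ((1 + matrix_spectral_radius P) / 2)"
    have r: "0 < r" "r < 1" "matrix_spectral_radius P < r"
      using assms(4) by (auto simp: r_def less_max_iff_disj)
    obtain C where C: "\<And>j v. norm (matrix_power P j *v v) \<le> C * r ^ j * norm v"
      using matrix_power_spectral_bound r by blast
    \<comment> \<open>Half of the decay rate of \<open>r ^ j\<close> is given to the growth of
      \<open>Z j\<close>; the other half leaves a geometric series with ratio
      \<open>exp (ln r / 2) < 1\<close>.\<close>
    have "0 < - ln r / 2"
      using r by simp
    with that have "AE x in M. eventually (\<lambda>j. norm (Z j x) \<le> exp (- ln r / 2 * real j)) sequentially"
      using iid_log_plus_moment_iff assms(2) by blast
    then show ?thesis
    proof eventually_elim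
      case (elim x)
      let ?q = "r * exp (- ln r / 2)"
      have "?q = exp (ln r) * exp (- ln r / 2)"
        using r by simp
      also have "\<dots> = exp (ln r / 2)"
        by (simp flip: exp_add)
      finally have "?q = exp (ln r / 2)" .
      then have q: "0 < ?q" "?q < 1"
        using r by auto
      have "eventually (\<lambda>j. norm (norm (matrix_power P j *v Z j x)) \<le> \<bar>C\<bar> * ?q ^ j) sequentially"
        using elim
      proof eventually_elim
        case (elim j)
        have "norm (matrix_power P j *v Z j x) \<le> C * r ^ j * norm (Z j x)"
          by (rule C)
        also have "\<dots> \<le> \<bar>C\<bar> * r ^ j * exp (- ln r / 2 * real j)"
          using elim r by (intro mult_mono) auto
        also have "\<dots> = \<bar>C\<bar> * ?q ^ j"
          by (simp only: power_mult_distrib exp_of_nat2_mult mult.assoc)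
        finally show ?case by simp
      qed
      then show ?case
        by (rule summable_comparison_test_ev) (use q in \<open>auto intro!: summable_mult summable_geometric\<close>)
    qed
  qed
  moreover have "?iii" if "?ii"
    using that by eventually_elim (rule summable_norm_cancel)
  moreover have "?iv" if "?iii"
    using that by eventually_elim (rule summable_LIMSEQ_zero)
  moreover have "?i" if "?iv"
  proof -
    obtain c where c: "0 < c" "c < 1" "\<And>j v. c ^ j * norm v \<le> norm (matrix_power P j *v v)"
      using invertible_matrix_power_lower_bound assms(3) by blast
    \<comment> \<open>The rate \<open>- ln c\<close> matches the lower bound exactly:
      \<open>exp (- ln c * j)\<close> is the inverse of \<open>c ^ j\<close>. Of the convergence to
      0, only the eventual bound by 1 is used.\<close>
    have "AE x in M. eventually (\<lambda>j. norm (Z j x) \<le> exp (- ln c * real j)) sequentially"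
      using that
    proof eventually_elim
      case (elim x)
      then have "eventually (\<lambda>j. norm (matrix_power P j *v Z j x) < 1) sequentially"
        by (auto dest!: tendstoD [where e = 1])
      then show ?case
      proof eventually_elim
        case (elim j)
        have "c ^ j * norm (Z j x) \<le> 1"
          using c(3) [of j "Z j x"] elim by linarith
        moreover have "c ^ j = inverse (exp (- ln c * real j))"
          using c by (simp add: exp_minus exp_of_nat2_mult)
        ultimately show ?case
          by (simp add: inverse_eq_divide divide_le_eq)
      qed
    qed
    moreover have "0 < - ln c"
      using c by simp
    ultimately show ?thesis
      using iid_log_plus_moment_iff assms(2) by blast
  qed
  ultimately show ?thesis by blast
qed

end
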